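(* Let $G$ be a simple connected graph with $n\ge 2$ vertices, diameter $d$ and Wiener index $W(G)$. Then $$DLS(G)\geq \frac{2n+d^2-2d+1}{2}-\frac{2W(G)}{n-1}.$$
   Context: All graphs are finite, simple and connected. For a connected graph $G$ on vertices $v_1,\dots,v_n$, $d_{uv}$ denotes the distance (length of a shortest path) between $u$ and $v$, and $D(G)=(d_{uv})$ is the distance matrix. The diameter is the maximum distance between two vertices. The transmission of a vertex $v$ is $Tr(v)=\sum_{u\in V(G)}d_{uv}$. The Wiener index is $W(G)=\frac12\sum_{u,v\in V(G)}d_{uv}$ (the sum of distances over unordered pairs of vertices). The distance Laplacian matrix is $D^L(G)=\mathrm{diag}(Tr(v_1),\dots,Tr(v_n))-D(G)$; it is positive semidefinite, and its eigenvalues, with multiplicity, are written $\partial_1^L(G)\ge \partial_2^L(G)\ge\dots\ge\partial_n^L(G)=0$. The distance Laplacian spread is $DLS(G)=\partial_1^L(G)-\partial_{n-1}^L(G)$. *)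

theory Defs
  imports
    "Graph_Theory.Digraph_Component"
    "Graph_Theory.Shortest_Path"
    "Jordan_Normal_Form.Char_Poly"
begin

text \<open>
  A finite simple graph is an instance of the locale \<^locale>\<open>graph\<close> of Graph Theory
  (finite symmetric digraph without loops and without parallel arcs): each undirected edge is a
  pair of opposite arcs, so the number of arcs of a path is its length in the usual sense.
\<close>

definition graph_dist :: "('a, 'b) pre_digraph \<Rightarrow> 'a \<Rightarrow> 'a \<Rightarrow> nat" where
  "graph_dist G u v = (LEAST k. \<exists>p. pre_digraph.apath G u p v \<and> length p = k)"

definition graph_diameter :: "('a, 'b) pre_digraph \<Rightarrow> nat" where
  "graph_diameter G = Max {graph_dist G u v | u v. u \<in> verts G \<and> v \<in> verts G}"

definition transmission :: "('a, 'b) pre_digraph \<Rightarrow> 'a \<Rightarrow> nat" where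
  "transmission G v = (\<Sum>u\<in>verts G. graph_dist G u v)"

definition wiener_index :: "('a, 'b) pre_digraph \<Rightarrow> real" where
  "wiener_index G = 1 / 2 * (\<Sum>u\<in>verts G. \<Sum>v\<in>verts G. real (graph_dist G u v))"

text \<open>
  In the matrices, \<open>vs = [v\<^sub>1, \<dots>, v\<^sub>n]\<close> is an enumeration of the vertices without repetition.
\<close>

definition dist_mat :: "('a, 'b) pre_digraph \<Rightarrow> 'a list \<Rightarrow> real mat" where
  "dist_mat G vs =
     mat (length vs) (length vs) (\<lambda>(i, j). real (graph_dist G (vs ! i) (vs ! j)))"

definition dist_laplacian :: "('a, 'b) pre_digraph \<Rightarrow> 'a list \<Rightarrow> real mat" where
  "dist_laplacian G vs =
     mat_diag (length vs) (\<lambda>i. real (transmission G (vs ! i))) - dist_mat G vs"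

text \<open>
  The real eigenvalues with algebraic multiplicity, in non-increasing order. For a real symmetric
  matrix of size \<open>n\<close> these are all the eigenvalues; see \<open>length_eigenvalues_desc\<close> below.
\<close>

definition eigenvalues_desc :: "real mat \<Rightarrow> real list" where
  "eigenvalues_desc A = rev (sorted_list_of_multiset (proots (char_poly A)))"

text \<open>The argument \<open>i\<close> of \<open>dist_laplacian_eig\<close> counts from 1, list positions count from 0.\<close>

definition dist_laplacian_eig :: "('a, 'b) pre_digraph \<Rightarrow> 'a list \<Rightarrow> nat \<Rightarrow> real" where
  "dist_laplacian_eig G vs i = eigenvalues_desc (dist_laplacian G vs) ! (i - 1)"

definition dist_laplacian_spread :: "('a, 'b) pre_digraph \<Rightarrow> 'a list \<Rightarrow> real" where
  "dist_laplacian_spread G vs =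
     dist_laplacian_eig G vs 1 - dist_laplacian_eig G vs (length vs - 1)"


subsection \<open>The definitions agree with library notions\<close>

lemma (in graph) graph_dist_eq_mu:
  assumes "u \<rightarrow>\<^sup>* v"
  shows "ereal (real (graph_dist G u v)) = \<mu> (\<lambda>_. 1) u v"
proof -
  have cost: "awalk_cost (\<lambda>_. 1) p = real (length p)" for p :: "'b list"
    by (induct p) auto
  obtain p where p: "apath u p v" "\<mu> (\<lambda>_. 1) u v = ereal (real (length p))"
    using min_cost_awalk[OF assms, of "\<lambda>_. 1"] cost by auto
  have "graph_dist G u v = length p"
    unfolding graph_dist_def
  proof (rule Least_equality)
    show "\<exists>q. apath u q v \<and> length q = length p" using p(1) by blast
  next
    fix k assume "\<exists>q. apath u q v \<and> length q = k"
    then obtain q where q: "awalk u q v" "length q = k" by (auto simp: apath_def)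
    have "ereal (real (length p)) \<le> ereal (awalk_cost (\<lambda>_. 1) q)"
      using min_cost_le_walk_cost[OF q(1), of "\<lambda>_. 1"] p(2) by simp
    then show "length p \<le> k" using q(2) cost by simp
  qed
  then show ?thesis using p(2) by simp
qed

lemma symmetric_real_eigenvalue_real:
  fixes A :: "real mat"
  assumes A: "A \<in> carrier_mat n n" and sym: "\<And>i j. i < n \<Longrightarrow> j < n \<Longrightarrow> A $$ (i, j) = A $$ (j, i)"
    and ev: "eigenvalue (map_mat complex_of_real A) k"
  shows "k = complex_of_real (Re k)"
proof -
  let ?A = "map_mat complex_of_real A"
  obtain v where v: "v \<in> carrier_vec n" "v \<noteq> 0\<^sub>v n" "?A *\<^sub>v v = k \<cdot>\<^sub>v v"
    using ev A unfolding eigenvalue_def eigenvector_def by auto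
  have row: "(\<Sum>j<n. of_real (A $$ (i, j)) * v $ j) = k * v $ i" if "i < n" for i
    using arg_cong[OF v(3), of "\<lambda>w. w $ i"] that A v(1)
    by (simp add: scalar_prod_def atLeast0LessThan)
  define N where "N = (\<Sum>i<n. (cmod (v $ i))\<^sup>2)"
  define S where "S = (\<Sum>i<n. \<Sum>j<n. of_real (A $$ (i, j)) * v $ j * cnj (v $ i))"
  have "S = (\<Sum>i<n. k * (v $ i * cnj (v $ i)))"
    unfolding S_def
  proof (rule sum.cong[OF refl])
    fix i assume "i \<in> {..<n}"
    then show "(\<Sum>j<n. of_real (A $$ (i, j)) * v $ j * cnj (v $ i)) = k * (v $ i * cnj (v $ i))"
      using row[of i] by (simp add: sum_distrib_right[symmetric])
  qed
  then have SN: "S = k * of_real N"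
    unfolding N_def by (simp add: sum_distrib_left complex_norm_square del: of_real_power)
  have "cnj S = (\<Sum>i<n. \<Sum>j<n. of_real (A $$ (i, j)) * cnj (v $ j) * v $ i)"
    unfolding S_def by simp
  also have "\<dots> = (\<Sum>j<n. \<Sum>i<n. of_real (A $$ (i, j)) * cnj (v $ j) * v $ i)"
    by (rule sum.swap)
  also have "\<dots> = S"
    unfolding S_def by (intro sum.cong refl) (auto simp: sym mult_ac)
  finally have "cnj k * of_real N = k * of_real N" using SN by simp
  moreover have "N \<noteq> 0"
  proof
    assume "N = 0"
    then have "\<forall>i<n. v $ i = 0" unfolding N_def by (subst (asm) sum_nonneg_eq_0_iff) auto
    then have "v = 0\<^sub>v n" using v(1) by (intro eq_vecI) auto
    then show False using v(2) by simp
  qed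
  ultimately have "cnj k = k" by simp
  then show ?thesis by (simp add: complex_eq_iff)
qed

lemma length_eigenvalues_desc:
  fixes A :: "real mat"
  assumes A: "A \<in> carrier_mat n n" and sym: "\<And>i j. i < n \<Longrightarrow> j < n \<Longrightarrow> A $$ (i, j) = A $$ (j, i)"
  shows "length (eigenvalues_desc A) = n"
proof -
  let ?A = "map_mat complex_of_real A"
  interpret h: map_poly_inj_comm_ring_hom "of_real :: real \<Rightarrow> complex" ..
  have cA: "?A \<in> carrier_mat n n" using A by simp
  obtain as where as: "char_poly ?A = (\<Prod>a\<leftarrow>as. [:- a, 1:])" "length as = n"
    using char_poly_factorized[OF cA] by blast
  have re: "a = complex_of_real (Re a)" if "a \<in> set as" for a
  proof (rule symmetric_real_eigenvalue_real[OF A sym])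
    show "eigenvalue ?A a"
      unfolding eigenvalue_root_char_poly[OF cA] as(1) poly_prod_list
      using that by (force simp: prod_list_zero_iff)
  qed
  have "char_poly ?A = map_poly complex_of_real (char_poly A)"
    by (rule of_real_hom.char_poly_hom[OF A])
  then have "map_poly complex_of_real (char_poly A) = (\<Prod>a\<leftarrow>as. [:- a, 1:])"
    using as(1) by simp
  also have "\<dots> = map_poly complex_of_real (\<Prod>a\<leftarrow>map Re as. [:- a, 1:])"
    using re
  proof (induct as)
    case (Cons a as)
    have "[:- a, 1:] = map_poly complex_of_real [:- Re a, 1:]"
      using Cons.prems[of a] by simp
    then show ?case
      using Cons by (simp add: h.hom_mult del: mult_pCons_left)
  qed simp
  finally have "char_poly A = (\<Prod>a\<leftarrow>map Re as. [:- a, 1:])" by (rule h.injectivity)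
  moreover have "proots (\<Prod>a\<leftarrow>bs. [:- a, 1:]) = mset bs" for bs :: "real list"
  proof (induct bs)
    case (Cons b bs)
    have "(\<Prod>a\<leftarrow>bs. [:- a, 1:]) \<noteq> 0" by (auto simp: prod_list_zero_iff)
    then show ?case
      using Cons by (simp add: proots_mult del: mult_pCons_left)
  qed simp
  ultimately have "proots (char_poly A) = mset (map Re as)" by metis
  then show ?thesis
    unfolding eigenvalues_desc_def using as(2)
    by (metis length_map length_rev mset_sorted_list_of_multiset size_mset)
qed

end

theory Submission
  imports Defs "Jordan_Normal_Form.Schur_Decomposition"
begin

text \<open>
  Let \<open>u\<close> and \<open>v\<close> be vertices at distance \<open>d\<close>. The Rayleigh quotient of \<open>D\<^sup>L\<close> at \<open>e\<^sub>u - e\<^sub>v\<close> is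
  \<open>(Tr u + Tr v + 2 d) / 2\<close>, and each of the \<open>n - 2\<close> other vertices contributes at least \<open>max d 2\<close>
  to \<open>Tr u + Tr v\<close>, by the triangle inequality and because its distances to \<open>u\<close> and \<open>v\<close> are positive.
  As \<open>n \<ge> d + 1\<close>, the largest eigenvalue is at least \<open>n + (d - 1)\<^sup>2 / 2\<close>. On the other hand the trace
  is \<open>2 W\<close> and no eigenvalue is negative, so the smallest of the first \<open>n - 1\<close> eigenvalues is at
  most \<open>2 W / (n - 1)\<close>. The Rayleigh bound comes from writing each vector as a sum of eigenvectors,
  which is done along the flag of a (non-orthogonal) Schur triangularization.
\<close>

section \<open>Real symmetric matrices\<close>

text \<open>Vectors are functions on all of \<open>nat\<close>, of which only the entries below the
  dimension matter. Families of vectors can then be summed pointwise, without carrier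
  conditions.\<close>

definition mat_app :: "real mat \<Rightarrow> (nat \<Rightarrow> real) \<Rightarrow> nat \<Rightarrow> real" where
  "mat_app A x i = (\<Sum>j<dim_col A. A $$ (i, j) * x j)"

definition dot :: "nat \<Rightarrow> (nat \<Rightarrow> real) \<Rightarrow> (nat \<Rightarrow> real) \<Rightarrow> real" where
  "dot n x y = (\<Sum>i<n. x i * y i)"

text \<open>A component \<open>f e\<close> may be zero, so \<open>S\<close> may contain numbers that
  are not eigenvalues. One component per element of a set, rather than per entry of a list, merges
  repeated eigenvalues, so that distinct components are orthogonal when \<open>A\<close> is
  symmetric.\<close>

definition is_eigen_sum :: "real mat \<Rightarrow> real set \<Rightarrow> (nat \<Rightarrow> real) \<Rightarrow> bool" where
  "is_eigen_sum A S x \<longleftrightarrow> (\<exists>f. (\<forall>e\<in>S. \<forall>i<dim_row A. mat_app A (f e) i = e * f e i) \<and>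
     (\<forall>i<dim_row A. x i = (\<Sum>e\<in>S. f e i)))"

lemma mat_app_cong:
  "(\<And>j. j < dim_col A \<Longrightarrow> x j = y j) \<Longrightarrow> mat_app A x i = mat_app A y i"
  unfolding mat_app_def by (intro sum.cong) auto

lemma mat_app_add: "mat_app A (\<lambda>j. x j + y j) i = mat_app A x i + mat_app A y i"
  unfolding mat_app_def by (simp add: distrib_left sum.distrib)

lemma mat_app_diff: "mat_app A (\<lambda>j. x j - y j) i = mat_app A x i - mat_app A y i"
  unfolding mat_app_def by (simp add: right_diff_distrib sum_subtractf)

lemma mat_app_scale: "mat_app A (\<lambda>j. c * x j) i = c * mat_app A x i"
  unfolding mat_app_def by (simp add: sum_distrib_left mult.left_commute)

lemma mat_app_sum: "mat_app A (\<lambda>j. \<Sum>k\<in>S. x k j) i = (\<Sum>k\<in>S. mat_app A (x k) i)"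
  unfolding mat_app_def by (subst sum.swap) (simp add: sum_distrib_left)

lemma dot_cong:
  "(\<And>i. i < n \<Longrightarrow> x i = x' i) \<Longrightarrow> (\<And>i. i < n \<Longrightarrow> y i = y' i) \<Longrightarrow> dot n x y = dot n x' y'"
  unfolding dot_def by (intro sum.cong) auto

lemma dot_commute: "dot n x y = dot n y x"
  unfolding dot_def by (simp add: mult.commute)

lemma dot_diff_left: "dot n (\<lambda>i. x i - y i) z = dot n x z - dot n y z"
  unfolding dot_def by (simp add: left_diff_distrib sum_subtractf)

lemma dot_scale_left: "dot n (\<lambda>i. c * x i) z = c * dot n x z"
  unfolding dot_def by (simp add: sum_distrib_left mult.assoc)

lemma dot_sum_left: "dot n (\<lambda>i. \<Sum>k\<in>S. x k i) z = (\<Sum>k\<in>S. dot n (x k) z)"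
  unfolding dot_def by (subst sum.swap) (simp add: sum_distrib_right)

lemma dot_scale_right: "dot n z (\<lambda>i. c * x i) = c * dot n z x"
  using dot_scale_left[of n c x z] by (simp add: dot_commute)

lemma dot_sum_right: "dot n z (\<lambda>i. \<Sum>k\<in>S. x k i) = (\<Sum>k\<in>S. dot n z (x k))"
  using dot_sum_left[of n x S z] by (simp add: dot_commute)

lemma dot_self_nonneg: "0 \<le> dot n x x"
  unfolding dot_def by (intro sum_nonneg) auto

lemma dot_self_eq_0: "dot n x x = 0 \<Longrightarrow> i < n \<Longrightarrow> x i = 0"
  unfolding dot_def by (subst (asm) sum_nonneg_eq_0_iff) auto

lemma is_eigen_sum_add:
  assumes "is_eigen_sum A S x" "is_eigen_sum A S y"
  shows "is_eigen_sum A S (\<lambda>i. x i + y i)"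
proof -
  obtain f g where
    "\<forall>e\<in>S. \<forall>i<dim_row A. mat_app A (f e) i = e * f e i" "\<forall>i<dim_row A. x i = (\<Sum>e\<in>S. f e i)"
    "\<forall>e\<in>S. \<forall>i<dim_row A. mat_app A (g e) i = e * g e i" "\<forall>i<dim_row A. y i = (\<Sum>e\<in>S. g e i)"
    using assms unfolding is_eigen_sum_def by metis
  then show ?thesis
    unfolding is_eigen_sum_def
    by (intro exI[of _ "\<lambda>e i. f e i + g e i"]) (simp add: mat_app_add sum.distrib distrib_left)
qed

lemma is_eigen_sum_scale:
  assumes "is_eigen_sum A S x"
  shows "is_eigen_sum A S (\<lambda>i. c * x i)"
proof -
  obtain f where
    "\<forall>e\<in>S. \<forall>i<dim_row A. mat_app A (f e) i = e * f e i" "\<forall>i<dim_row A. x i = (\<Sum>e\<in>S. f e i)"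
    using assms unfolding is_eigen_sum_def by metis
  then show ?thesis
    unfolding is_eigen_sum_def
    by (intro exI[of _ "\<lambda>e i. c * f e i"]) (simp add: mat_app_scale sum_distrib_left)
qed

lemma is_eigen_sum_zero: "is_eigen_sum A S (\<lambda>i. 0)"
  unfolding is_eigen_sum_def by (rule exI[of _ "\<lambda>e i. 0"]) (simp add: mat_app_def)

lemma is_eigen_sum_sum:
  assumes "\<And>k. k \<in> K \<Longrightarrow> is_eigen_sum A S (x k)"
  shows "is_eigen_sum A S (\<lambda>i. \<Sum>k\<in>K. x k i)"
  using assms
  by (induction K rule: infinite_finite_induct) (auto simp: is_eigen_sum_zero is_eigen_sum_add)

lemma is_eigen_sum_cong:
  assumes "is_eigen_sum A S x" "\<And>i. i < dim_row A \<Longrightarrow> y i = x i"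
  shows "is_eigen_sum A S y"
  using assms unfolding is_eigen_sum_def by simp

section \<open>Spectral decomposition of a real symmetric matrix\<close>

context
  fixes A :: "real mat" and n :: nat
  assumes A: "A \<in> carrier_mat n n"
    and sym: "\<And>i j. i < n \<Longrightarrow> j < n \<Longrightarrow> A $$ (i, j) = A $$ (j, i)"
begin

lemma dot_mat_app: "dot n (mat_app A x) y = dot n x (mat_app A y)"
proof -
  have "dot n (mat_app A x) y = (\<Sum>i<n. \<Sum>j<n. A $$ (i, j) * x j * y i)"
    using A unfolding dot_def mat_app_def by (simp add: sum_distrib_right)
  also have "\<dots> = (\<Sum>j<n. \<Sum>i<n. A $$ (i, j) * x j * y i)" by (rule sum.swap)
  also have "\<dots> = dot n x (mat_app A y)"
    using A unfolding dot_def mat_app_def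
    by (simp add: sum_distrib_left) (intro sum.cong refl, auto simp: sym)
  finally show ?thesis .
qed

text \<open>Moving \<open>A\<close> from one factor to the other turns \<open>e\<close> into
  \<open>e'\<close>. Both vectors may be zero, so this applies to all components of an eigen
  sum.\<close>

lemma eigen_orthogonal:
  assumes "\<And>i. i < n \<Longrightarrow> mat_app A x i = e * x i" "\<And>i. i < n \<Longrightarrow> mat_app A y i = e' * y i" "e \<noteq> e'"
  shows "dot n x y = 0"
proof -
  have "e * dot n x y = dot n (mat_app A x) y"
    by (subst dot_scale_left[symmetric]) (rule dot_cong, auto simp: assms)
  also have "\<dots> = dot n x (mat_app A y)" by (rule dot_mat_app)
  also have "\<dots> = e' * dot n x y"
    by (subst dot_scale_right[symmetric]) (rule dot_cong, auto simp: assms)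
  finally show ?thesis using assms(3) by simp
qed

text \<open>
  The component of \<open>A x - e x\<close> for the eigenvalue \<open>e\<close> itself vanishes, because by symmetry
  \<open>A x - e x\<close> is orthogonal to every eigenvector for \<open>e\<close>; the other components can be divided by
  \<open>e' - e\<close>.
\<close>
lemma is_eigen_sum_step:
  assumes fin: "finite S" and e: "e \<in> S"
    and sum: "is_eigen_sum A S (\<lambda>i. mat_app A x i - e * x i)"
  shows "is_eigen_sum A S x"
proof -
  have dims: "dim_row A = n" "dim_col A = n" using A by auto
  obtain f where f: "\<And>a i. a \<in> S \<Longrightarrow> i < n \<Longrightarrow> mat_app A (f a) i = a * f a i"
    and fx: "\<And>i. i < n \<Longrightarrow> mat_app A x i - e * x i = (\<Sum>a\<in>S. f a i)"
    using sum dims unfolding is_eigen_sum_def by auto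
  \<comment> \<open>The components for the other elements of \<open>S\<close> are orthogonal to
    \<open>f e\<close>, so only the term \<open>a = e\<close> survives.\<close>
  have "dot n (f e) (f e) = (\<Sum>a\<in>S. dot n (f a) (f e))"
  proof -
    have "(\<Sum>a\<in>S - {e}. dot n (f a) (f e)) = 0"
      by (intro sum.neutral ballI eigen_orthogonal) (auto simp: f e)
    then show ?thesis using fin e by (simp add: sum.remove)
  qed
  also have "\<dots> = dot n (\<lambda>i. mat_app A x i - e * x i) (f e)"
    by (subst dot_sum_left[symmetric]) (rule dot_cong, auto simp: fx)
  \<comment> \<open>Self-adjointness shifts \<open>A\<close> onto \<open>f e\<close>, where it acts
    as \<open>e\<close>; the two terms cancel.\<close>
  also have "\<dots> = dot n x (mat_app A (f e)) - dot n x (\<lambda>i. e * f e i)"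
    by (simp add: dot_diff_left dot_mat_app dot_scale_left dot_scale_right)
  also have "dot n x (mat_app A (f e)) = dot n x (\<lambda>i. e * f e i)"
    by (rule dot_cong) (auto simp: f e)
  finally have fe: "f e i = 0" if "i < n" for i
    using dot_self_eq_0 that by simp
  \<comment> \<open>\<open>A - e\<close> multiplies \<open>f a\<close> by \<open>a - e\<close>, so
    the subtracted sum is a preimage of \<open>A x - e x\<close> under \<open>A - e\<close>. Hence
    \<open>z\<close> lies in the kernel of \<open>A - e\<close> and serves as the component for
    \<open>e\<close>.\<close>
  define z where "z i = x i - (\<Sum>a\<in>S - {e}. 1 / (a - e) * f a i)" for i
  define g where "g a = (if a = e then z else (\<lambda>i. 1 / (a - e) * f a i))" for a
  have z: "mat_app A z i = e * z i" if "i < n" for i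
  proof -
    have "mat_app A z i = mat_app A x i - (\<Sum>a\<in>S - {e}. 1 / (a - e) * (a * f a i))"
      unfolding z_def using that
      by (simp only: mat_app_diff mat_app_sum mat_app_scale) (simp add: f)
    moreover have "mat_app A x i = e * x i + (\<Sum>a\<in>S - {e}. f a i)"
      using fx[OF that] fe[OF that] fin e by (simp add: sum.remove)
    \<comment> \<open>This is \<open>a / (a - e) = 1 + e / (a - e)\<close>.\<close>
    moreover have "(\<Sum>a\<in>S - {e}. 1 / (a - e) * (a * f a i)) =
        (\<Sum>a\<in>S - {e}. f a i + e * (1 / (a - e) * f a i))"
      by (intro sum.cong refl) (simp add: field_simps)
    ultimately show ?thesis
      unfolding z_def by (simp add: sum.distrib sum_distrib_left right_diff_distrib)
  qed
  show ?thesis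
    unfolding is_eigen_sum_def dims
  proof (intro exI[of _ g] conjI ballI allI impI)
    fix a i assume "a \<in> S" "i < n"
    then show "mat_app A (g a) i = a * g a i"
      unfolding g_def by (cases "a = e") (simp_all add: z mat_app_scale f del: times_divide_eq_left)
  next
    fix i assume "i < n"
    have "(\<Sum>a\<in>S. g a i) = g e i + (\<Sum>a\<in>S - {e}. g a i)" using fin e by (simp add: sum.remove)
    also have "(\<Sum>a\<in>S - {e}. g a i) = (\<Sum>a\<in>S - {e}. 1 / (a - e) * f a i)"
      by (intro sum.cong) (auto simp: g_def)
    finally show "x i = (\<Sum>a\<in>S. g a i)" by (simp add: g_def z_def)
  qed
qed

text \<open>In a Schur form \<open>A = P B Q\<close> with \<open>B\<close> upper triangular,
  \<open>A - B $$ (k, k)\<close> maps column \<open>k\<close> of \<open>P\<close> into the span of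
  the earlier columns. Strong induction with \<open>is_eigen_sum_step\<close> therefore reaches
  every column, and the columns span the space.\<close>

lemma is_eigen_sum_symmetric:
  assumes cp: "char_poly A = (\<Prod>a\<leftarrow>es. [:- a, 1:])"
  shows "is_eigen_sum A (set es) x"
proof -
  obtain B P Q where dec: "schur_decomposition A es = (B, P, Q)"
    by (cases "schur_decomposition A es") auto
  have sim: "similar_mat_wit A B P Q" and ut: "upper_triangular B" and diag: "diag_mat B = es"
    using schur_decomposition[OF A cp dec] by auto
  note w = similar_mat_witD2[OF A sim]
  have dims: "dim_row A = n" "dim_col A = n" using A by auto
  have AP_eq: "A * P = P * B"
  proof -
    have "A * P = P * B * Q * P" by (simp only: w(3)[symmetric])
    also have "\<dots> = P * B * (Q * P)" using w(5-7) by (intro assoc_mult_mat) auto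
    finally show ?thesis using w(2,5,6) by simp
  qed
  have AP: "mat_app A (\<lambda>j. P $$ (j, k)) i = (\<Sum>l<n. P $$ (i, l) * B $$ (l, k))"
    if "i < n" "k < n" for i k
    using arg_cong[OF AP_eq, of "\<lambda>M. M $$ (i, k)"] that w(5,6) A
    by (simp add: scalar_prod_def mat_app_def atLeast0LessThan)
  have col: "is_eigen_sum A (set es) (\<lambda>j. P $$ (j, k))" if "k < n" for k
    using that
  proof (induction k rule: less_induct)
    case (less k)
    have mem: "B $$ (k, k) \<in> set es"
      using less.prems w(5) unfolding diag[symmetric] diag_mat_def by auto
    show ?case
    proof (rule is_eigen_sum_step[OF _ mem])
      have "is_eigen_sum A (set es) (\<lambda>i. \<Sum>l<k. B $$ (l, k) * P $$ (i, l))"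
        using less by (intro is_eigen_sum_sum is_eigen_sum_scale) auto
      then show "is_eigen_sum A (set es)
          (\<lambda>i. mat_app A (\<lambda>j. P $$ (j, k)) i - B $$ (k, k) * P $$ (i, k))"
      proof (rule is_eigen_sum_cong)
        fix i assume "i < dim_row A"
        then have i: "i < n" using dims by simp
        \<comment> \<open>Entries of \<open>B\<close> below the diagonal vanish, so the sum stops at
          \<open>k\<close>; its last term is the one subtracted in the goal.\<close>
        have "(\<Sum>l<n. P $$ (i, l) * B $$ (l, k)) = (\<Sum>l<Suc k. P $$ (i, l) * B $$ (l, k))"
          using less.prems w(5) ut by (intro sum.mono_neutral_right) (auto simp: upper_triangular_def)
        then show "mat_app A (\<lambda>j. P $$ (j, k)) i - B $$ (k, k) * P $$ (i, k) =
            (\<Sum>l<k. B $$ (l, k) * P $$ (i, l))"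
          using AP[OF i less.prems] by (simp add: mult.commute)
      qed
    qed simp
  qed
  \<comment> \<open>\<open>y\<close> is \<open>Q x\<close>, the coordinates of \<open>x\<close> in
    the columns of \<open>P\<close>, since \<open>P Q = 1\<close>.\<close>
  define y where "y k = (\<Sum>j<n. Q $$ (k, j) * x j)" for k
  have "is_eigen_sum A (set es) (\<lambda>i. \<Sum>k<n. y k * P $$ (i, k))"
    using col by (intro is_eigen_sum_sum is_eigen_sum_scale) auto
  then show ?thesis
  proof (rule is_eigen_sum_cong)
    fix i assume "i < dim_row A"
    then have i: "i < n" using dims by simp
    have PQ: "(\<Sum>k<n. P $$ (i, k) * Q $$ (k, j)) = (if i = j then 1 else 0)" if "j < n" for j
      using arg_cong[OF w(1), of "\<lambda>M. M $$ (i, j)"] that i w(6,7)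
      by (simp add: scalar_prod_def atLeast0LessThan)
    have "(\<Sum>k<n. y k * P $$ (i, k)) = (\<Sum>j<n. (\<Sum>k<n. P $$ (i, k) * Q $$ (k, j)) * x j)"
      unfolding y_def sum_distrib_right by (subst sum.swap) (simp add: mult_ac)
    also have "\<dots> = (\<Sum>j<n. if i = j then x j else 0)"
      by (intro sum.cong refl) (simp add: PQ)
    also have "\<dots> = x i" using i by simp
    finally show "x i = (\<Sum>k<n. y k * P $$ (i, k))" by simp
  qed
qed

text \<open>For orthogonal components \<open>f a\<close> of \<open>x\<close>, the left side is the
  sum of \<open>a * dot n (f a) (f a)\<close>, while \<open>dot n x x\<close> is the same sum
  without the factors \<open>a\<close>.\<close>

lemma rayleigh_le:
  assumes cp: "char_poly A = (\<Prod>a\<leftarrow>es. [:- a, 1:])"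
    and le: "\<And>e. e \<in> set es \<Longrightarrow> e \<le> \<mu>"
  shows "dot n (mat_app A x) x \<le> \<mu> * dot n x x"
proof -
  let ?S = "set es"
  have dims: "dim_row A = n" "dim_col A = n" using A by auto
  obtain f where f: "\<And>a i. a \<in> ?S \<Longrightarrow> i < n \<Longrightarrow> mat_app A (f a) i = a * f a i"
    and fx: "\<And>i. i < n \<Longrightarrow> x i = (\<Sum>a\<in>?S. f a i)"
    using is_eigen_sum_symmetric[OF cp, of x] dims unfolding is_eigen_sum_def by auto
  have fdot: "dot n (f a) x = dot n (f a) (f a)" if "a \<in> ?S" for a
  proof -
    have "dot n (f a) x = (\<Sum>b\<in>?S. dot n (f a) (f b))"
      by (subst dot_sum_right[symmetric]) (rule dot_cong, auto simp: fx)
    also have "\<dots> = (\<Sum>b\<in>?S. if b = a then dot n (f a) (f a) else 0)"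
      using that by (intro sum.cong refl) (auto intro!: eigen_orthogonal f)
    finally show ?thesis using that by simp
  qed
  have "dot n (mat_app A x) x = dot n (\<lambda>i. \<Sum>a\<in>?S. a * f a i) x"
  proof (rule dot_cong)
    fix i assume i: "i < n"
    have "mat_app A x i = mat_app A (\<lambda>j. \<Sum>a\<in>?S. f a j) i"
      by (rule mat_app_cong) (simp add: fx dims)
    then show "mat_app A x i = (\<Sum>a\<in>?S. a * f a i)" by (simp add: mat_app_sum f i)
  qed simp
  also have "\<dots> = (\<Sum>a\<in>?S. a * dot n (f a) (f a))"
    by (simp add: dot_sum_left dot_scale_left fdot)
  also have "\<dots> \<le> (\<Sum>a\<in>?S. \<mu> * dot n (f a) (f a))"
    by (intro sum_mono mult_right_mono le dot_self_nonneg)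
  also have "\<dots> = \<mu> * dot n (\<lambda>i. \<Sum>a\<in>?S. f a i) x"
    by (simp add: dot_sum_left fdot sum_distrib_left)
  also have "dot n (\<lambda>i. \<Sum>a\<in>?S. f a i) x = dot n x x"
    by (rule dot_cong) (auto simp: fx)
  finally show ?thesis .
qed

lemma eigenvalue_nonneg:
  assumes psd: "\<And>x. 0 \<le> dot n (mat_app A x) x" and ev: "eigenvalue A e"
  shows "0 \<le> e"
proof -
  obtain v where v: "v \<in> carrier_vec n" "v \<noteq> 0\<^sub>v n" "A *\<^sub>v v = e \<cdot>\<^sub>v v"
    using ev A unfolding eigenvalue_def eigenvector_def by auto
  have row: "mat_app A (($) v) i = e * v $ i" if "i < n" for i
    using arg_cong[OF v(3), of "\<lambda>w. w $ i"] that A v(1)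
    by (simp add: scalar_prod_def mat_app_def atLeast0LessThan)
  have "dot n (mat_app A (($) v)) (($) v) = e * dot n (($) v) (($) v)"
    by (subst dot_scale_left[symmetric]) (rule dot_cong, auto simp: row)
  moreover have "dot n (($) v) (($) v) \<noteq> 0"
    using dot_self_eq_0[of n "($) v"] v(1,2) by (metis carrier_vecD eq_vecI index_zero_vec)
  ultimately show ?thesis
    using psd[of "($) v"] dot_self_nonneg[of n "($) v"] by (simp add: zero_le_mult_iff)
qed

end

section \<open>Trace and characteristic polynomial\<close>

lemma sum_diag_mult_commute:
  fixes M N :: "'a :: comm_ring_1 mat"
  assumes "M \<in> carrier_mat n n" "N \<in> carrier_mat n n"
  shows "(\<Sum>i<n. (M * N) $$ (i, i)) = (\<Sum>i<n. (N * M) $$ (i, i))"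
proof -
  have "(\<Sum>i<n. (M * N) $$ (i, i)) = (\<Sum>i<n. \<Sum>j<n. M $$ (i, j) * N $$ (j, i))"
    using assms by (simp add: scalar_prod_def atLeast0LessThan)
  also have "\<dots> = (\<Sum>j<n. \<Sum>i<n. M $$ (i, j) * N $$ (j, i))" by (rule sum.swap)
  also have "\<dots> = (\<Sum>i<n. (N * M) $$ (i, i))"
    using assms by (simp add: scalar_prod_def atLeast0LessThan mult.commute)
  finally show ?thesis .
qed

text \<open>The trace is invariant under similarity, and the triangular Schur form has diagonal
  \<open>es\<close>.\<close>

lemma sum_diag_eq_sum_list:
  fixes A :: "'a :: conjugatable_ordered_field mat"
  assumes A: "A \<in> carrier_mat n n" and cp: "char_poly A = (\<Prod>a\<leftarrow>es. [:- a, 1:])"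
  shows "(\<Sum>i<n. A $$ (i, i)) = sum_list es"
proof -
  obtain B P Q where dec: "schur_decomposition A es = (B, P, Q)"
    by (cases "schur_decomposition A es") auto
  have sim: "similar_mat_wit A B P Q" and diag: "diag_mat B = es"
    using schur_decomposition[OF A cp dec] by auto
  note w = similar_mat_witD2[OF A sim]
  have "(\<Sum>i<n. A $$ (i, i)) = (\<Sum>i<n. (P * (B * Q)) $$ (i, i))"
    by (subst w(3)) (simp add: assoc_mult_mat[OF w(6) w(5) w(7)])
  also have "\<dots> = (\<Sum>i<n. ((B * Q) * P) $$ (i, i))"
    using w(5-7) by (intro sum_diag_mult_commute) auto
  also have "(B * Q) * P = B"
    using w(2,5) by (simp add: assoc_mult_mat[OF w(5) w(7) w(6)])
  also have "(\<Sum>i<n. B $$ (i, i)) = sum_list es"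
    using w(5) unfolding diag[symmetric] diag_mat_def
    by (simp add: interv_sum_list_conv_sum_set_nat atLeast0LessThan)
  finally show ?thesis .
qed

text \<open>Dividing out one root removes exactly one copy of it from \<open>proots\<close>, so the
  rest of the list stays contained in the roots of the quotient.\<close>

lemma prod_linear_dvd:
  fixes p :: "'a :: idom poly"
  assumes "p \<noteq> 0" "mset es \<subseteq># proots p"
  shows "(\<Prod>a\<leftarrow>es. [:- a, 1:]) dvd p"
  using assms
proof (induction es arbitrary: p)
  case (Cons a es)
  have "a \<in># proots p" using Cons.prems(2) by (metis list.set_intros(1) mset_subset_eqD set_mset_mset)
  then have "poly p a = 0" using Cons.prems(1) by simp
  then obtain q where q: "p = [:- a, 1:] * q" by (auto simp: poly_eq_0_iff_dvd)
  with Cons.prems(1) have "q \<noteq> 0" by auto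
  moreover have "proots p = {#a#} + proots q"
    unfolding q using \<open>q \<noteq> 0\<close> by (subst proots_mult) auto
  ultimately show ?case
    using Cons by (simp add: q mult_dvd_mono del: mult_pCons_left)
qed simp

text \<open>The product divides the characteristic polynomial. Both are monic of degree
  \<open>n\<close>, the product because symmetry makes all \<open>n\<close> eigenvalues real, so the
  cofactor is 1.\<close>

lemma char_poly_eigenvalues_desc:
  fixes A :: "real mat"
  assumes A: "A \<in> carrier_mat n n" and sym: "\<And>i j. i < n \<Longrightarrow> j < n \<Longrightarrow> A $$ (i, j) = A $$ (j, i)"
  shows "char_poly A = (\<Prod>a\<leftarrow>eigenvalues_desc A. [:- a, 1:])"
proof -
  let ?es = "eigenvalues_desc A" and ?p = "char_poly A"
  have p: "degree ?p = n" "coeff ?p n = 1" using degree_monic_char_poly[OF A] by auto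
  then have "?p \<noteq> 0" by auto
  moreover have "mset ?es = proots ?p" by (simp add: eigenvalues_desc_def)
  ultimately have "(\<Prod>a\<leftarrow>?es. [:- a, 1:]) dvd ?p" by (intro prod_linear_dvd) auto
  then obtain q where q: "?p = (\<Prod>a\<leftarrow>?es. [:- a, 1:]) * q" by (elim dvdE)
  have deg: "degree (\<Prod>a\<leftarrow>?es. [:- a, 1:]) = n"
    using degree_linear_factors[of uminus ?es] length_eigenvalues_desc[OF A sym] by simp
  have lead: "lead_coeff (\<Prod>a\<leftarrow>?es. [:- a, 1:]) = 1"
    by (intro monic_prod_list) auto
  have "q \<noteq> 0" "(\<Prod>a\<leftarrow>?es. [:- a, 1:]) \<noteq> 0" using q \<open>?p \<noteq> 0\<close> by auto
  then have "degree q = 0" using q deg p(1) by (metis add_cancel_right_right degree_mult_eq)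
  moreover have "lead_coeff q = 1"
    using lead p q by (metis lead_coeff_mult mult_1)
  ultimately have "q = 1" by (metis degree_0_id one_pCons)
  then show ?thesis using q by simp
qed

lemma eigenvalues_desc_antimono:
  assumes "i \<le> j" "j < length (eigenvalues_desc A)"
  shows "eigenvalues_desc A ! j \<le> eigenvalues_desc A ! i"
  using assms unfolding eigenvalues_desc_def
  by (metis sorted_rev_nth_mono rev_rev_ident sorted_sorted_list_of_multiset)

section \<open>Graph distance\<close>

context graph
begin

text \<open>\<open>graph_dist\<close> minimizes over paths only. Comparison with
  \<open>\<mu>\<close> extends the bound to walks, so walks can be concatenated or reversed without
  removing repeated vertices.\<close>

lemma graph_dist_le_length:
  assumes p: "awalk u p v"
  shows "graph_dist G u v \<le> length p"
proof -
  have cost: "awalk_cost (\<lambda>_. 1) q = real (length q)" for q :: "'b list"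
    by (induct q) auto
  have "u \<rightarrow>\<^sup>* v" using p by (rule reachable_awalkI)
  then show ?thesis
    using min_cost_le_walk_cost[OF p, of "\<lambda>_. 1"] graph_dist_eq_mu[symmetric] cost by simp
qed

lemma apath_graph_dist:
  assumes "u \<rightarrow>\<^sup>* v"
  obtains p where "apath u p v" "length p = graph_dist G u v"
proof -
  obtain p where "apath u p v" using assms by (metis reachable_apath)
  then have "\<exists>k p. apath u p v \<and> length p = k" by blast
  from LeastI_ex[OF this] show ?thesis using that unfolding graph_dist_def by blast
qed

lemma awalk_reverse:
  assumes "awalk u p v"
  shows "\<exists>q. awalk v q u \<and> length q = length p"
  using assms
proof (induction p arbitrary: u)
  case Nil
  then show ?case by (auto simp: awalk_Nil_iff intro!: exI[of _ "[]"])
next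
  case (Cons e p)
  then have e: "e \<in> arcs G" "u = tail G e" "awalk (head G e) p v" by (auto simp: awalk_Cons_iff)
  obtain q where q: "awalk v q (head G e)" "length q = length p" using Cons.IH[OF e(3)] by blast
  obtain e' where e': "e' \<in> arcs G" "tail G e = head G e'" "head G e = tail G e'"
    using sym_arcs e(1) unfolding symmetric_conv by blast
  have "awalk (head G e) [e'] u" using e e' by (simp add: awalk_simps)
  with q(1) have "awalk v (q @ [e']) u" by (rule awalk_appendI)
  then show ?case using q(2) by (intro exI[of _ "q @ [e']"]) simp
qed

lemma graph_dist_self: "u \<in> verts G \<Longrightarrow> graph_dist G u u = 0"
  using graph_dist_le_length[of u "[]" u] by (simp add: awalk_Nil_iff)

lemma graph_dist_commute_le:
  assumes "u \<rightarrow>\<^sup>* v"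
  shows "graph_dist G v u \<le> graph_dist G u v"
  using apath_graph_dist[OF assms] awalk_reverse graph_dist_le_length
  by (metis awalkI_apath)

lemma graph_dist_commute:
  assumes "u \<rightarrow>\<^sup>* v"
  shows "graph_dist G u v = graph_dist G v u"
  using graph_dist_commute_le[OF assms] graph_dist_commute_le[of v u]
    symmetric_reachable[OF sym_arcs assms] by simp

lemma graph_dist_triangle:
  assumes "u \<rightarrow>\<^sup>* v" "v \<rightarrow>\<^sup>* w"
  shows "graph_dist G u w \<le> graph_dist G u v + graph_dist G v w"
proof -
  obtain p q where "apath u p v" "length p = graph_dist G u v"
    "apath v q w" "length q = graph_dist G v w"
    using apath_graph_dist[OF assms(1)] apath_graph_dist[OF assms(2)] by metis
  moreover from this have "awalk u (p @ q) w" by (metis awalk_appendI awalkI_apath)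
  ultimately show ?thesis using graph_dist_le_length[of u "p @ q" w] by simp
qed

lemma graph_dist_pos:
  assumes "u \<rightarrow>\<^sup>* v" "u \<noteq> v"
  shows "1 \<le> graph_dist G u v"
proof -
  obtain p where p: "apath u p v" "length p = graph_dist G u v" using apath_graph_dist[OF assms(1)] .
  then have "p \<noteq> []" using assms(2) by (auto simp: apath_Nil_iff)
  then show ?thesis using p(2) by (cases p) auto
qed

text \<open>A shortest path repeats no vertex. Applied to a diametral pair, this gives
  \<open>n \<ge> d + 1\<close>.\<close>

lemma graph_dist_less_card:
  assumes "u \<rightarrow>\<^sup>* v"
  shows "graph_dist G u v < card (verts G)"
  using apath_graph_dist[OF assms] length_apath_less by metis

lemma finite_graph_dists: "finite {graph_dist G u v | u v. u \<in> verts G \<and> v \<in> verts G}"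
proof -
  have "{graph_dist G u v | u v. u \<in> verts G \<and> v \<in> verts G} =
      (\<lambda>(u, v). graph_dist G u v) ` (verts G \<times> verts G)" by auto
  then show ?thesis by simp
qed

lemma graph_diameter_attained:
  assumes "verts G \<noteq> {}"
  obtains u v where "u \<in> verts G" "v \<in> verts G" "graph_dist G u v = graph_diameter G"
proof -
  let ?D = "{graph_dist G u v | u v. u \<in> verts G \<and> v \<in> verts G}"
  have "?D \<noteq> {}" using assms by auto
  with finite_graph_dists have "Max ?D \<in> ?D" by (rule Max_in)
  then show ?thesis using that unfolding graph_diameter_def by auto
qed

lemma graph_dist_le_diameter:
  assumes "u \<in> verts G" "v \<in> verts G"
  shows "graph_dist G u v \<le> graph_diameter G"
  unfolding graph_diameter_def by (rule Max_ge[OF finite_graph_dists]) (use assms in auto)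

lemma transmission_add_ge:
  assumes conn: "\<And>u v. u \<in> verts G \<Longrightarrow> v \<in> verts G \<Longrightarrow> u \<rightarrow>\<^sup>* v"
    and uv: "u \<in> verts G" "v \<in> verts G" "u \<noteq> v" and d: "graph_dist G u v = d"
  shows "(card (verts G) - 2) * max d 2 + 2 * d \<le> transmission G u + transmission G v"
proof -
  let ?V = "verts G" and ?c = "\<lambda>w. graph_dist G w u + graph_dist G w v"
  have "(card ?V - 2) * max d 2 = (\<Sum>w\<in>?V - {u, v}. max d 2)"
    using uv by (simp add: card_Diff_subset)
  also have "\<dots> \<le> (\<Sum>w\<in>?V - {u, v}. ?c w)"
  proof (rule sum_mono)
    fix w assume w: "w \<in> ?V - {u, v}"
    have "d \<le> graph_dist G u w + graph_dist G w v"
      using graph_dist_triangle[of u w v] conn uv w d by blast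
    also have "graph_dist G u w = graph_dist G w u"
      using w uv by (intro graph_dist_commute conn) auto
    finally show "max d 2 \<le> ?c w"
      using graph_dist_pos[of w u] graph_dist_pos[of w v] conn uv w by fastforce
  qed
  finally have "(card ?V - 2) * max d 2 \<le> (\<Sum>w\<in>?V - {u, v}. ?c w)" .
  moreover have "(\<Sum>w\<in>?V. ?c w) = (\<Sum>w\<in>{u, v}. ?c w) + (\<Sum>w\<in>?V - {u, v}. ?c w)"
    using uv by (subst sum.subset_diff[of "{u, v}"]) (auto simp: add.commute)
  \<comment> \<open>Each of \<open>u\<close> and \<open>v\<close> is at distance 0 from itself and
    \<open>d\<close> from the other.\<close>
  moreover have "(\<Sum>w\<in>{u, v}. ?c w) = 2 * d"
    using uv d graph_dist_self[of u] graph_dist_self[of v] graph_dist_commute[of u v] conn by simp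
  ultimately show ?thesis by (simp add: transmission_def sum.distrib)
qed

end

section \<open>The distance Laplacian\<close>

theorem theorem4p2:
  fixes G :: "('a, 'b) pre_digraph" and vs :: "'a list" and n d :: nat
  assumes "Digraph.graph G"
    and "Digraph_Component.connected G"
    and "distinct vs" and "set vs = verts G"
    and "n = card (verts G)" and "n \<ge> 2"
    and "d = graph_diameter G"
  shows "dist_laplacian_spread G vs \<ge>
    (2 * real n + (real d)\<^sup>2 - 2 * real d + 1) / 2 - 2 * wiener_index G / (real n - 1)"
proof -
  interpret graph G by fact
  let ?L = "dist_laplacian G vs" and ?es = "eigenvalues_desc (dist_laplacian G vs)"
  define D where "D i j = real (graph_dist G (vs ! i) (vs ! j))" for i j
  have len: "length vs = n" using assms(3-5) distinct_card by metis
  have conn: "u \<rightarrow>\<^sup>*\<^bsub>G\<^esub> v" if "u \<in> verts G" "v \<in> verts G" for u v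
    using symmetric_connected_imp_strongly_connected[OF sym_arcs assms(2)] that by auto
  have vs_in: "vs ! i \<in> verts G" if "i < n" for i using that len assms(4) nth_mem by blast
  have sum_verts: "(\<Sum>w\<in>verts G. h w) = (\<Sum>j<n. h (vs ! j))" for h :: "'a \<Rightarrow> real"
    using sum.reindex_bij_betw[OF bij_betw_nth[OF assms(3) refl assms(4)[symmetric]], of h] len by simp
  have D_commute: "D i j = D j i" if "i < n" "j < n" for i j
    using that graph_dist_commute[OF conn[OF vs_in vs_in]] by (simp add: D_def)
  have D_self: "D i i = 0" if "i < n" for i
    using that graph_dist_self[OF vs_in] by (simp add: D_def)
  have Tr: "real (transmission G (vs ! i)) = (\<Sum>j<n. D i j)" if "i < n" for i
    using that sum_verts[of "\<lambda>w. real (graph_dist G w (vs ! i))"] D_commute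
    by (simp add: transmission_def D_def)
  have L: "?L \<in> carrier_mat n n" 
    by (simp add: dist_laplacian_def dist_mat_def len mat_diag_def minus_carrier_mat)
  have L_entry: "?L $$ (i, j) = (if i = j then (\<Sum>k<n. D i k) else 0) - D i j" if "i < n" "j < n" for i j
    using that Tr by (simp add: dist_laplacian_def dist_mat_def len mat_diag_def D_def)
  have L_sym: "?L $$ (i, j) = ?L $$ (j, i)" if "i < n" "j < n" for i j
    using that D_commute by (simp add: L_entry)
  have cp: "char_poly ?L = (\<Prod>a\<leftarrow>?es. [:- a, 1:])"
    by (rule char_poly_eigenvalues_desc[OF L L_sym])
  have len_es: "length ?es = n" by (rule length_eigenvalues_desc[OF L L_sym])
  \<comment> \<open>The Dirichlet form of the distance Laplacian; nonnegativity of distances makes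
    it positive semidefinite.\<close>
  have form: "dot n (mat_app ?L x) x = 1 / 2 * (\<Sum>i<n. \<Sum>j<n. D i j * (x i - x j)\<^sup>2)" for x
  proof -
    have app: "mat_app ?L x i = (\<Sum>j<n. D i j * (x i - x j))" if "i < n" for i
    proof -
      have "mat_app ?L x i = (\<Sum>j<n. (if i = j then (\<Sum>k<n. D i k) * x i else 0) - D i j * x j)"
        using that L unfolding mat_app_def
        by (intro sum.cong) (auto simp: L_entry left_diff_distrib)
      then show ?thesis
        using that by (simp add: sum_subtractf right_diff_distrib sum_distrib_right)
    qed
    have "dot n (mat_app ?L x) x = (\<Sum>i<n. \<Sum>j<n. D i j * (x i - x j) * x i)"
      unfolding dot_def by (simp add: app sum_distrib_right)
    \<comment> \<open>Exchanging \<open>i\<close> and \<open>j\<close> gives a second expression for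
      the form; adding the two produces the squares and explains the factor
      \<open>1 / 2\<close>.\<close>
    moreover have "(\<Sum>i<n. \<Sum>j<n. D i j * (x i - x j) * x i) =
        (\<Sum>i<n. \<Sum>j<n. D i j * (x j - x i) * x j)"
      by (subst sum.swap) (intro sum.cong refl, simp add: D_commute)
    moreover have "(\<Sum>i<n. \<Sum>j<n. D i j * (x i - x j)\<^sup>2) =
        (\<Sum>i<n. \<Sum>j<n. D i j * (x i - x j) * x i) + (\<Sum>i<n. \<Sum>j<n. D i j * (x j - x i) * x j)"
      unfolding sum.distrib[symmetric]
      by (intro sum.cong refl) (simp add: power2_eq_square algebra_simps)
    ultimately show ?thesis by simp
  qed
  have nonneg: "0 \<le> e" if "e \<in> set ?es" for e
  proof (rule eigenvalue_nonneg[OF L L_sym])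
    show "0 \<le> dot n (mat_app ?L x) x" for x
      unfolding form by (intro mult_nonneg_nonneg sum_nonneg) (auto simp: D_def)
    show "eigenvalue ?L e"
      unfolding eigenvalue_root_char_poly[OF L] cp poly_prod_list
      using that by (force simp: prod_list_zero_iff)
  qed

  \<comment> \<open>Upper bound for the eigenvalue in position \<open>n - 2\<close>\<close>
  have "(real n - 1) * ?es ! (n - 2) = (\<Sum>i<n - 1. ?es ! (n - 2))"
    using \<open>n \<ge> 2\<close> by (simp add: of_nat_diff)
  also have "\<dots> \<le> (\<Sum>i<n - 1. ?es ! i)"
    by (intro sum_mono eigenvalues_desc_antimono) (use len_es \<open>n \<ge> 2\<close> in auto)
  \<comment> \<open>The last eigenvalue is added so that the full sum becomes the trace, which is
    the sum of all transmissions.\<close>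
  also have "\<dots> \<le> (\<Sum>i<n. ?es ! i)"
    by (rule sum_mono2) (use len_es nonneg in auto)
  also have "\<dots> = (\<Sum>i<n. ?L $$ (i, i))"
    using sum_diag_eq_sum_list[OF L cp] len_es by (simp add: sum_list_sum_nth atLeast0LessThan)
  also have "\<dots> = 2 * wiener_index G"
    unfolding wiener_index_def sum_verts by (simp add: L_entry D_self) (simp add: D_def)
  finally have upper: "?es ! (n - 2) \<le> 2 * wiener_index G / (real n - 1)"
    using \<open>n \<ge> 2\<close> by (simp add: pos_le_divide_eq mult.commute)

  \<comment> \<open>Lower bound for the largest eigenvalue\<close>
  have "verts G \<noteq> {}" using assms(5,6) by auto
  then obtain u v where uv: "u \<in> verts G" "v \<in> verts G" "graph_dist G u v = d"
    using graph_diameter_attained assms(7) by metis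
  have d_less: "d < n" using graph_dist_less_card[OF conn[OF uv(1,2)]] uv(3) assms(5) by simp
  \<comment> \<open>Two distinct vertices force \<open>d \<ge> 1\<close>, so the diametral pair
    consists of distinct vertices.\<close>
  have "vs ! 0 \<noteq> vs ! 1" using assms(3,6) len by (simp add: nth_eq_iff_index_eq)
  then have "1 \<le> graph_dist G (vs ! 0) (vs ! 1)"
    using assms(6) by (intro graph_dist_pos conn vs_in) auto
  also have "\<dots> \<le> d"
    unfolding assms(7) using assms(6) by (intro graph_dist_le_diameter vs_in) auto
  finally have d_pos: "1 \<le> d" .
  have "u \<noteq> v" using d_pos uv(1,3) graph_dist_self by auto
  obtain a b where ab: "a < n" "b < n" "vs ! a = u" "vs ! b = v"
    using uv(1,2) assms(4) len by (metis in_set_conv_nth)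
  then have "a \<noteq> b" using \<open>u \<noteq> v\<close> by auto
  define x :: "nat \<Rightarrow> real" where "x i = (if i = a then 1 else 0) - (if i = b then 1 else 0)" for i
  have app: "mat_app ?L x i = ?L $$ (i, a) - ?L $$ (i, b)" for i
    using ab L unfolding mat_app_def x_def
    by (simp add: right_diff_distrib sum_subtractf if_distrib[of "(*) c" for c] cong: if_cong)
  have dot_x: "dot n y x = y a - y b" for y
    using ab unfolding dot_def x_def
    by (simp add: right_diff_distrib sum_subtractf if_distrib[of "(*) c" for c] cong: if_cong)
  have dot_xx: "dot n x x = 2" unfolding dot_x using \<open>a \<noteq> b\<close> by (simp add: x_def)
  have "dot n (mat_app ?L x) x \<le> ?es ! 0 * dot n x x"
  proof (rule rayleigh_le[OF L L_sym cp])
    fix e assume "e \<in> set ?es"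
    then obtain i where "i < length ?es" "e = ?es ! i" by (auto simp: in_set_conv_nth)
    then show "e \<le> ?es ! 0" by (simp add: eigenvalues_desc_antimono)
  qed
  \<comment> \<open>The two diagonal entries are the transmissions; the two off-diagonal entries
    \<open>- d\<close> enter with negative sign.\<close>
  moreover have "dot n (mat_app ?L x) x = real (transmission G u + transmission G v) + 2 * real d"
    unfolding dot_x app using ab \<open>a \<noteq> b\<close> uv(3) D_commute[of a b] Tr[of a] Tr[of b] D_self[of a] D_self[of b]
    by (simp add: L_entry D_def)
  moreover have "real ((n - 2) * max d 2 + 2 * d) \<le> real (transmission G u + transmission G v)"
    unfolding of_nat_le_iff assms(5) using \<open>u \<noteq> v\<close> by (intro transmission_add_ge conn uv)
  \<comment> \<open>For \<open>d = 1\<close> both sides equal \<open>2 * n\<close>. For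
    \<open>d \<ge> 2\<close> the right side is \<open>n * d + 2 * d\<close>, and
    \<open>n \<ge> d + 1\<close> multiplied by \<open>d - 2\<close> leaves a slack of
    \<open>3 * d - 3\<close>.\<close>
  moreover have "2 * real n + (real d - 1)\<^sup>2 \<le> real ((n - 2) * max d 2 + 2 * d) + 2 * real d"
  proof (cases "d = 1")
    case True
    then show ?thesis using \<open>n \<ge> 2\<close> by (simp add: of_nat_diff)
  next
    case False
    then have "d \<ge> 2" using d_pos by simp
    moreover have "(real d + 1) * (real d - 2) \<le> real n * (real d - 2)"
      using d_less \<open>d \<ge> 2\<close> by (intro mult_right_mono) auto
    ultimately show ?thesis
      using \<open>n \<ge> 2\<close> by (simp add: of_nat_diff power2_eq_square algebra_simps)
  qed
  ultimately have lower: "real n + (real d - 1)\<^sup>2 / 2 \<le> ?es ! 0" unfolding dot_xx by linarith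
  have "(2 * real n + (real d)\<^sup>2 - 2 * real d + 1) / 2 = real n + (real d - 1)\<^sup>2 / 2"
    by (simp add: power2_eq_square algebra_simps add_divide_distrib diff_divide_distrib)
  \<comment> \<open>Eigenvalue number \<open>n - 1\<close>, counted from 1, sits in list position
    \<open>n - 2\<close>.\<close>
  moreover have "dist_laplacian_spread G vs = ?es ! 0 - ?es ! (n - 2)"
    unfolding dist_laplacian_spread_def dist_laplacian_eig_def len
    by (simp only: diff_diff_left diff_self_eq_0 one_add_one)
  ultimately show ?thesis using lower upper by linarith
qed

end
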